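(* Let $\mathscr{A}$ be a (locally small, well-powered and well-copowered) locally finite category admitting a proper factorisation system $(\mathscr{Q},\mathscr{M})$ such that $\mathscr{A}$ is $\mathscr{M}$-well-founded. Then $\mathscr{A}$ is left-combinatorial; that is, for all objects $a,b\in\mathscr{A}$, one has $a\cong b$ if and only if for every object $c\in\mathscr{A}$ there is a bijection $\hom_{\mathscr{A}}(a,c)\cong\hom_{\mathscr{A}}(b,c)$.
   Context: A category $\mathscr{A}$ is locally finite if $\hom_{\mathscr{A}}(a,b)$ is a finite set for all objects $a,b$. A proper factorisation system on $\mathscr{A}$ is a pair $(\mathscr{Q},\mathscr{M})$ of classes of morphisms such that: every morphism $f$ factors as $f=m\circ e$ with $e\in\mathscr{Q}$, $m\in\mathscr{M}$; $\mathscr{Q}$ is exactly the class of morphisms with the left lifting property with respect to all morphisms of $\mathscr{M}$, and $\mathscr{M}$ is exactly the class of morphisms with the right lifting property with respect to all morphisms of $\mathscr{Q}$ (fillers not required to be unique); every morphism in $\mathscr{Q}$ is an epimorphism and every morphism in $\mathscr{M}$ is a monomorphism. Morphisms in $\mathscr{M}$ are called embeddings. For an object $a$, $\mathscr{M}(a)$ is the poset of embeddings with codomain $a$, where $m\leq n$ iff $m=n\circ i$ for some morphism $i$, modulo the equivalence relation identifying $m$ and $n$ when $m\leq n$ and $n\leq m$. $\mathscr{A}$ is $\mathscr{M}$-well-founded if for every object $a$ each non-empty subset of $\mathscr{M}(a)$ has a minimal element. *)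

theory Defs
  imports Main "HOL-Library.Equipollence"
begin

text \<open>
  The objects and the morphisms of a category form sets over two arbitrary types; these play
  the role of (possibly large) classes.  In
  \<open>g \<cdot>\<^bsub>C\<^esub> f\<close> the morphism \<open>f\<close> comes first; composition is only constrained
  when \<open>Dom C g = Cod C f\<close>.
\<close>

record ('o, 'm) category =
  Obj :: "'o set"
  Mor :: "'m set"
  Dom :: "'m \<Rightarrow> 'o"
  Cod :: "'m \<Rightarrow> 'o"
  Ident :: "'o \<Rightarrow> 'm"
  Comp :: "'m \<Rightarrow> 'm \<Rightarrow> 'm" (infixl "\<cdot>\<index>" 70)

definition hom :: "('o, 'm) category \<Rightarrow> 'o \<Rightarrow> 'o \<Rightarrow> 'm set" where
  "hom C a b = {f \<in> Mor C. Dom C f = a \<and> Cod C f = b}"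

locale category =
  fixes C :: "('o, 'm) category" (structure)
  assumes Dom_in_Obj: "f \<in> Mor C \<Longrightarrow> Dom C f \<in> Obj C"
    and Cod_in_Obj: "f \<in> Mor C \<Longrightarrow> Cod C f \<in> Obj C"
    and Ident_in_hom: "a \<in> Obj C \<Longrightarrow> Ident C a \<in> hom C a a"
    and Comp_in_hom: "f \<in> hom C a b \<Longrightarrow> g \<in> hom C b c \<Longrightarrow> g \<cdot> f \<in> hom C a c"
    and Comp_Ident: "f \<in> hom C a b \<Longrightarrow> f \<cdot> Ident C a = f"
    and Ident_Comp: "f \<in> hom C a b \<Longrightarrow> Ident C b \<cdot> f = f"
    and Comp_assoc: "f \<in> hom C a b \<Longrightarrow> g \<in> hom C b c \<Longrightarrow> h \<in> hom C c d \<Longrightarrow>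
                       (h \<cdot> g) \<cdot> f = h \<cdot> (g \<cdot> f)"

definition opposite :: "('o, 'm) category \<Rightarrow> ('o, 'm) category" where
  "opposite C = \<lparr>Obj = Obj C, Mor = Mor C, Dom = Cod C, Cod = Dom C, Ident = Ident C,
                 Comp = (\<lambda>g f. f \<cdot>\<^bsub>C\<^esub> g)\<rparr>"

definition monic :: "('o, 'm) category \<Rightarrow> 'm \<Rightarrow> bool" where
  "monic C m \<longleftrightarrow> m \<in> Mor C \<and>
     (\<forall>x \<in> Obj C. \<forall>f \<in> hom C x (Dom C m). \<forall>g \<in> hom C x (Dom C m).
        m \<cdot>\<^bsub>C\<^esub> f = m \<cdot>\<^bsub>C\<^esub> g \<longrightarrow> f = g)"

definition epic :: "('o, 'm) category \<Rightarrow> 'm \<Rightarrow> bool" where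
  "epic C e \<longleftrightarrow> e \<in> Mor C \<and>
     (\<forall>x \<in> Obj C. \<forall>f \<in> hom C (Cod C e) x. \<forall>g \<in> hom C (Cod C e) x.
        f \<cdot>\<^bsub>C\<^esub> e = g \<cdot>\<^bsub>C\<^esub> e \<longrightarrow> f = g)"

definition isomorphic :: "('o, 'm) category \<Rightarrow> 'o \<Rightarrow> 'o \<Rightarrow> bool" where
  "isomorphic C a b \<longleftrightarrow>
     (\<exists>f \<in> hom C a b. \<exists>g \<in> hom C b a. g \<cdot>\<^bsub>C\<^esub> f = Ident C a \<and> f \<cdot>\<^bsub>C\<^esub> g = Ident C b)"


subsection \<open>Subobjects\<close>

definition factors_through :: "('o, 'm) category \<Rightarrow> 'm \<Rightarrow> 'm \<Rightarrow> bool" where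
  "factors_through C m n \<longleftrightarrow> (\<exists>i \<in> hom C (Dom C m) (Dom C n). m = n \<cdot>\<^bsub>C\<^esub> i)"

definition subobject_rel :: "('o, 'm) category \<Rightarrow> 'm set \<Rightarrow> 'o \<Rightarrow> 'm rel" where
  "subobject_rel C M a =
     {(m, n). m \<in> M \<and> n \<in> M \<and> Cod C m = a \<and> Cod C n = a \<and>
              factors_through C m n \<and> factors_through C n m}"

text \<open>The poset of morphisms of the class \<open>M\<close> with codomain \<open>a\<close>, up to equivalence.\<close>

definition subobjects :: "('o, 'm) category \<Rightarrow> 'm set \<Rightarrow> 'o \<Rightarrow> 'm set set" where
  "subobjects C M a = {m \<in> M. Cod C m = a} // subobject_rel C M a"

definition subobject_le :: "('o, 'm) category \<Rightarrow> 'm set \<Rightarrow> 'm set \<Rightarrow> bool" where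
  "subobject_le C X Y \<longleftrightarrow> (\<exists>m \<in> X. \<exists>n \<in> Y. factors_through C m n)"

definition M_well_founded :: "('o, 'm) category \<Rightarrow> 'm set \<Rightarrow> bool" where
  "M_well_founded C M \<longleftrightarrow>
     (\<forall>a \<in> Obj C. \<forall>S. S \<subseteq> subobjects C M a \<and> S \<noteq> {} \<longrightarrow>
        (\<exists>X \<in> S. \<forall>Y \<in> S. subobject_le C Y X \<longrightarrow> Y = X))"


subsection \<open>Size conditions\<close>

text \<open>
  Smallness is relative to a type \<open>'u\<close> of any cardinality: a collection is small if it is in
  bijection with a set of elements of \<open>'u\<close>.
\<close>

definition locally_small :: "'u itself \<Rightarrow> ('o, 'm) category \<Rightarrow> bool" where
  "locally_small (U :: 'u itself) C \<longleftrightarrow>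
     (\<forall>a \<in> Obj C. \<forall>b \<in> Obj C. hom C a b \<lesssim> (UNIV :: 'u set))"

definition well_powered :: "'u itself \<Rightarrow> ('o, 'm) category \<Rightarrow> bool" where
  "well_powered (U :: 'u itself) C \<longleftrightarrow>
     (\<forall>a \<in> Obj C. subobjects C {m. monic C m} a \<lesssim> (UNIV :: 'u set))"

definition well_copowered :: "'u itself \<Rightarrow> ('o, 'm) category \<Rightarrow> bool" where
  "well_copowered U C \<longleftrightarrow> well_powered U (opposite C)"

definition locally_finite :: "('o, 'm) category \<Rightarrow> bool" where
  "locally_finite C \<longleftrightarrow> (\<forall>a \<in> Obj C. \<forall>b \<in> Obj C. finite (hom C a b))"


subsection \<open>Proper factorisation systems\<close>

text \<open>\<open>e\<close> has the left lifting property with respect to \<open>m\<close>; fillers need not be unique.\<close>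

definition lifts_against :: "('o, 'm) category \<Rightarrow> 'm \<Rightarrow> 'm \<Rightarrow> bool" where
  "lifts_against C e m \<longleftrightarrow>
     (\<forall>u \<in> hom C (Dom C e) (Dom C m). \<forall>v \<in> hom C (Cod C e) (Cod C m).
        m \<cdot>\<^bsub>C\<^esub> u = v \<cdot>\<^bsub>C\<^esub> e \<longrightarrow>
        (\<exists>d \<in> hom C (Cod C e) (Dom C m). d \<cdot>\<^bsub>C\<^esub> e = u \<and> m \<cdot>\<^bsub>C\<^esub> d = v))"

definition proper_factorisation_system ::
  "('o, 'm) category \<Rightarrow> 'm set \<Rightarrow> 'm set \<Rightarrow> bool" where
  "proper_factorisation_system C Q M \<longleftrightarrow>
     (\<forall>f \<in> Mor C. \<exists>e \<in> Q. \<exists>m \<in> M.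
        Dom C e = Dom C f \<and> Cod C e = Dom C m \<and> Cod C m = Cod C f \<and> f = m \<cdot>\<^bsub>C\<^esub> e) \<and>
     Q = {e \<in> Mor C. \<forall>m \<in> M. lifts_against C e m} \<and>
     M = {m \<in> Mor C. \<forall>e \<in> Q. lifts_against C e m} \<and>
     (\<forall>e \<in> Q. epic C e) \<and>
     (\<forall>m \<in> M. monic C m)"


subsection \<open>Left-combinatorial categories\<close>

definition left_combinatorial :: "('o, 'm) category \<Rightarrow> bool" where
  "left_combinatorial C \<longleftrightarrow>
     (\<forall>a \<in> Obj C. \<forall>b \<in> Obj C.
        isomorphic C a b \<longleftrightarrow> (\<forall>c \<in> Obj C. hom C a c \<approx> hom C b c))"


subsection \<open>Basic facts\<close>

lemma hom_opposite: "hom (opposite C) a b = hom C b a"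
  by (auto simp: hom_def opposite_def)

lemma (in category) category_opposite: "category (opposite C)"
  by (rule category.intro, unfold hom_opposite)
    (auto simp: opposite_def Dom_in_Obj Cod_in_Obj Ident_in_hom Comp_in_hom Comp_Ident
      Ident_Comp Comp_assoc)

lemma monic_opposite: "monic (opposite C) e \<longleftrightarrow> epic C e"
  by (simp add: monic_def epic_def opposite_def hom_def) blast

lemma (in category) factors_through_refl:
  "m \<in> Mor C \<Longrightarrow> factors_through C m m"
  unfolding factors_through_def
  by (metis (mono_tags, lifting) Comp_Ident Dom_in_Obj Ident_in_hom hom_def mem_Collect_eq)

lemma (in category) factors_through_trans:
  assumes "n \<in> Mor C" "p \<in> Mor C" "factors_through C m n" "factors_through C n p"
  shows "factors_through C m p"
proof -
  obtain i j where i: "i \<in> hom C (Dom C m) (Dom C n)" "m = n \<cdot> i"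
    and j: "j \<in> hom C (Dom C n) (Dom C p)" "n = p \<cdot> j"
    using assms unfolding factors_through_def by blast
  have "p \<in> hom C (Dom C p) (Cod C p)" using assms by (simp add: hom_def)
  then have "m = p \<cdot> (j \<cdot> i)" using Comp_assoc[OF i(1) j(1)] i(2) j(2) by metis
  then show ?thesis using Comp_in_hom[OF i(1) j(1)] unfolding factors_through_def by blast
qed

lemma (in category) equiv_subobject_rel:
  assumes "M \<subseteq> Mor C"
  shows "equiv {m \<in> M. Cod C m = a} (subobject_rel C M a)"
proof (rule equivI)
  show "refl_on {m \<in> M. Cod C m = a} (subobject_rel C M a)"
    using assms by (auto simp: refl_on_def subobject_rel_def intro: factors_through_refl)
  show "sym (subobject_rel C M a)" by (auto simp: sym_def subobject_rel_def)
  show "trans (subobject_rel C M a)"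
    using assms by (auto simp: trans_def subobject_rel_def intro: factors_through_trans)
qed (auto simp: subobject_rel_def)

lemma (in category) subobject_le_iff:
  assumes "M \<subseteq> Mor C" "m \<in> M" "Cod C m = a" "n \<in> M" "Cod C n = a"
  shows "subobject_le C (subobject_rel C M a `` {m}) (subobject_rel C M a `` {n}) \<longleftrightarrow>
         factors_through C m n"
proof
  assume "subobject_le C (subobject_rel C M a `` {m}) (subobject_rel C M a `` {n})"
  then obtain m' n' where "(m, m') \<in> subobject_rel C M a" "(n, n') \<in> subobject_rel C M a"
    "factors_through C m' n'"
    by (auto simp: subobject_le_def)
  then show "factors_through C m n"
    using assms(1) unfolding subobject_rel_def
    by simp (meson factors_through_trans subsetD)
next
  assume "factors_through C m n"
  moreover have "(m, m) \<in> subobject_rel C M a" "(n, n) \<in> subobject_rel C M a"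
    using assms by (auto simp: subobject_rel_def intro: factors_through_refl)
  ultimately show "subobject_le C (subobject_rel C M a `` {m}) (subobject_rel C M a `` {n})"
    unfolding subobject_le_def by blast
qed

end

theory Submission
  imports Defs
begin

text \<open>
  Every morphism \<open>a \<rightarrow> s\<close> factors through an \<open>M\<close>-subobject of \<open>s\<close> that is unique up to
  equivalence, so the cardinality of \<open>hom a s\<close> is the sum over the subobjects \<open>t\<close> of \<open>s\<close> of the
  number of \<open>Q\<close>-morphisms \<open>a \<rightarrow> t\<close>; only finitely many summands are nonzero.  If \<open>hom a c\<close> and
  \<open>hom b c\<close> are equinumerous for all \<open>c\<close>, well-founded induction over the subobjects of \<open>c\<close>
  therefore shows that there are as many \<open>Q\<close>-morphisms \<open>a \<rightarrow> c\<close> as \<open>b \<rightarrow> c\<close>.  The identities lie in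
  \<open>Q\<close>, hence there are \<open>Q\<close>-morphisms \<open>e : a \<rightarrow> b\<close> and \<open>e' : b \<rightarrow> a\<close>.  The composite of \<open>e\<close>
  and \<open>e'\<close> is an epic endomorphism of \<open>a\<close>, and precomposition with it is an injective, hence
  surjective, self-map of the finite set \<open>hom a a\<close>; thus \<open>e\<close> is epic and split monic.
\<close>

section \<open>Cancellation, and isomorphisms from pairs of opposite epimorphisms\<close>

context category
begin

lemma hom_Obj: "f \<in> hom C a b \<Longrightarrow> a \<in> Obj C" "f \<in> hom C a b \<Longrightarrow> b \<in> Obj C"
  using Dom_in_Obj Cod_in_Obj by (auto simp: hom_def)

lemma Mor_hom: "f \<in> Mor C \<Longrightarrow> f \<in> hom C (Dom C f) (Cod C f)"
  by (simp add: hom_def)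

lemma epic_cancel:
  assumes "epic C e" "e \<in> hom C a b" "f \<in> hom C b c" "g \<in> hom C b c" "f \<cdot> e = g \<cdot> e"
  shows "f = g"
  using assms hom_Obj(2)[OF assms(3)] unfolding epic_def hom_def by blast

lemma monic_cancel:
  assumes "monic C m" "m \<in> hom C b c" "f \<in> hom C a b" "g \<in> hom C a b" "m \<cdot> f = m \<cdot> g"
  shows "f = g"
  using assms hom_Obj(1)[OF assms(3)] unfolding monic_def hom_def by blast

lemma isomorphic_hom_eqpoll:
  assumes "isomorphic C a b"
  shows "hom C a c \<approx> hom C b c"
proof -
  obtain f g where f: "f \<in> hom C a b" and g: "g \<in> hom C b a"
    and gf: "g \<cdot> f = Ident C a" and fg: "f \<cdot> g = Ident C b"
    using assms unfolding isomorphic_def by blast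
  have "bij_betw (\<lambda>h. h \<cdot> g) (hom C a c) (hom C b c)"
  proof (rule bij_betw_byWitness[where f' = "\<lambda>h. h \<cdot> f"])
    show "\<forall>h\<in>hom C a c. h \<cdot> g \<cdot> f = h"
      using f g gf by (simp add: Comp_assoc Comp_Ident)
    show "\<forall>h\<in>hom C b c. h \<cdot> f \<cdot> g = h"
      using f g fg by (simp add: Comp_assoc Comp_Ident)
  qed (use f g Comp_in_hom in auto)
  then show ?thesis unfolding eqpoll_def by blast
qed

lemma isomorphic_if_epics:
  assumes fin: "finite (hom C a a)"
    and e: "epic C e" "e \<in> hom C a b" and e': "epic C e'" "e' \<in> hom C b a"
  shows "isomorphic C a b"
proof -
  note a = hom_Obj(1)[OF e(2)] and b = hom_Obj(2)[OF e(2)]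
  have inj: "inj_on (\<lambda>h. h \<cdot> (e' \<cdot> e)) (hom C a a)"
  proof (rule inj_onI)
    fix h k assume hk: "h \<in> hom C a a" "k \<in> hom C a a" and eq: "h \<cdot> (e' \<cdot> e) = k \<cdot> (e' \<cdot> e)"
    then have "(h \<cdot> e') \<cdot> e = (k \<cdot> e') \<cdot> e" using e e' by (simp add: Comp_assoc)
    then have "h \<cdot> e' = k \<cdot> e'"
      using epic_cancel[OF e Comp_in_hom[OF e'(2) hk(1)] Comp_in_hom[OF e'(2) hk(2)]] by blast
    then show "h = k" using epic_cancel[OF e' hk] by blast
  qed
  have "(\<lambda>h. h \<cdot> (e' \<cdot> e)) ` hom C a a \<subseteq> hom C a a"
    using e e' Comp_in_hom by blast
  then have "(\<lambda>h. h \<cdot> (e' \<cdot> e)) ` hom C a a = hom C a a"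
    using inj fin endo_inj_surj by blast
  then obtain h where h: "h \<in> hom C a a" "h \<cdot> (e' \<cdot> e) = Ident C a"
    using Ident_in_hom[OF a] by (metis (no_types, lifting) imageE)
  define g where "g = h \<cdot> e'"
  have g: "g \<in> hom C b a" using h e' Comp_in_hom unfolding g_def by blast
  have ge: "g \<cdot> e = Ident C a" using h e e' by (simp add: g_def Comp_assoc)
  \<comment> \<open>So far \<open>g\<close> is only a left inverse of \<open>e\<close>; cancelling
    the epimorphism \<open>e\<close> on the right makes it two-sided.\<close>
  have "(e \<cdot> g) \<cdot> e = Ident C b \<cdot> e"
    using e g ge by (simp add: Comp_assoc Comp_Ident Ident_Comp)
  then have "e \<cdot> g = Ident C b"
    using epic_cancel[OF e] Comp_in_hom[OF g e(2)] Ident_in_hom[OF b] by blast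
  then show ?thesis using e g ge unfolding isomorphic_def by blast
qed

end

section \<open>Lifting and closure properties of the two classes\<close>

locale proper_factorisation_category = category +
  fixes Q M
  assumes pfs: "proper_factorisation_system C Q M"
begin

lemma Q_epic: "e \<in> Q \<Longrightarrow> epic C e"
  using pfs unfolding proper_factorisation_system_def by blast

lemma M_monic: "m \<in> M \<Longrightarrow> monic C m"
  using pfs unfolding proper_factorisation_system_def by blast

lemma M_Mor: "M \<subseteq> Mor C"
  using M_monic unfolding monic_def by blast

lemma factorisation:
  assumes "f \<in> hom C a b"
  obtains e m t where "e \<in> Q" "m \<in> M" "e \<in> hom C a t" "m \<in> hom C t b" "f = m \<cdot> e"
proof -
  have f: "f \<in> Mor C" "Dom C f = a" "Cod C f = b" using assms by (auto simp: hom_def)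
  then obtain e m where em: "e \<in> Q" "m \<in> M" "Dom C e = a" "Cod C e = Dom C m"
    "Cod C m = b" "f = m \<cdot> e"
    using pfs unfolding proper_factorisation_system_def by metis
  then have "e \<in> Mor C" "m \<in> Mor C" using Q_epic M_monic by (auto simp: epic_def monic_def)
  then show thesis using em that unfolding hom_def by blast
qed

lemma lift:
  assumes "e \<in> Q" "m \<in> M" "e \<in> hom C a b" "m \<in> hom C c d" "u \<in> hom C a c" "v \<in> hom C b d"
    "m \<cdot> u = v \<cdot> e"
  obtains w where "w \<in> hom C b c" "w \<cdot> e = u" "m \<cdot> w = v"
proof -
  have "lifts_against C e m"
    using pfs assms(1,2) unfolding proper_factorisation_system_def by blast
  moreover have "Dom C e = a" "Cod C e = b" "Dom C m = c" "Cod C m = d"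
    using assms(3,4) by (auto simp: hom_def)
  ultimately have "\<exists>w\<in>hom C b c. w \<cdot> e = u \<and> m \<cdot> w = v"
    using assms(5-7) unfolding lifts_against_def by simp
  then show thesis using that by blast
qed

lemma Q_I:
  assumes "e \<in> hom C a b"
    and "\<And>m c d u v. m \<in> M \<Longrightarrow> m \<in> hom C c d \<Longrightarrow> u \<in> hom C a c \<Longrightarrow> v \<in> hom C b d \<Longrightarrow>
      m \<cdot> u = v \<cdot> e \<Longrightarrow> \<exists>w\<in>hom C b c. w \<cdot> e = u \<and> m \<cdot> w = v"
  shows "e \<in> Q"
proof -
  have "Q = {e \<in> Mor C. \<forall>m \<in> M. lifts_against C e m}"
    using pfs unfolding proper_factorisation_system_def by blast
  moreover have "lifts_against C e m" if "m \<in> M" for m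
    unfolding lifts_against_def
    using assms that M_Mor Mor_hom[of m] by (auto simp: hom_def)
  ultimately show ?thesis using assms(1) by (auto simp: hom_def)
qed

lemma M_I:
  assumes "m \<in> hom C c d"
    and "\<And>e a b u v. e \<in> Q \<Longrightarrow> e \<in> hom C a b \<Longrightarrow> u \<in> hom C a c \<Longrightarrow> v \<in> hom C b d \<Longrightarrow>
      m \<cdot> u = v \<cdot> e \<Longrightarrow> \<exists>w\<in>hom C b c. w \<cdot> e = u \<and> m \<cdot> w = v"
  shows "m \<in> M"
proof -
  have "M = {m \<in> Mor C. \<forall>e \<in> Q. lifts_against C e m}"
    using pfs unfolding proper_factorisation_system_def by blast
  moreover have "lifts_against C e m" if "e \<in> Q" for e
    unfolding lifts_against_def
    using assms that Q_epic[OF that] by (auto simp: hom_def epic_def)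
  ultimately show ?thesis using assms(1) by (auto simp: hom_def)
qed

text \<open>Needed because a class of embeddings has many representatives: changing the
  representative changes the \<open>Q\<close>-part of a factorisation by an isomorphism. A filler
  for \<open>e\<close> becomes one for \<open>i \<cdot> e\<close> by precomposing with the inverse
  \<open>j\<close>.\<close>

lemma iso_Comp_Q:
  assumes e: "e \<in> Q" "e \<in> hom C a b" and i: "i \<in> hom C b c" and j: "j \<in> hom C c b"
    and ji: "j \<cdot> i = Ident C b" and ij: "i \<cdot> j = Ident C c"
  shows "i \<cdot> e \<in> Q"
proof (rule Q_I[OF Comp_in_hom[OF e(2) i]])
  fix m p q u v
  assume m: "m \<in> M" "m \<in> hom C p q" and u: "u \<in> hom C a p" and v: "v \<in> hom C c q"
    and eq: "m \<cdot> u = v \<cdot> (i \<cdot> e)"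
  have "m \<cdot> u = (v \<cdot> i) \<cdot> e" using eq e i v by (simp add: Comp_assoc)
  then obtain w where w: "w \<in> hom C b p" "w \<cdot> e = u" "m \<cdot> w = v \<cdot> i"
    using lift[OF e(1) m(1) e(2) m(2) u Comp_in_hom[OF i v]] by blast
  have "(w \<cdot> j) \<cdot> (i \<cdot> e) = w \<cdot> ((j \<cdot> i) \<cdot> e)"
    using w(1) i j e(2) Comp_in_hom[OF e(2) i] by (simp add: Comp_assoc)
  also have "\<dots> = u" using ji e w by (simp add: Ident_Comp)
  finally have 1: "(w \<cdot> j) \<cdot> (i \<cdot> e) = u" .
  have "m \<cdot> (w \<cdot> j) = (v \<cdot> i) \<cdot> j" using w m j by (simp flip: Comp_assoc)
  also have "\<dots> = v" using v i j ij by (simp add: Comp_assoc Comp_Ident)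
  finally show "\<exists>w\<in>hom C c p. w \<cdot> (i \<cdot> e) = u \<and> m \<cdot> w = v"
    using 1 Comp_in_hom[OF j w(1)] by blast
qed

lemma Ident_Q:
  assumes "a \<in> Obj C"
  shows "Ident C a \<in> Q"
  using Comp_Ident Ident_in_hom[OF assms] by (intro Q_I[of _ a a]) metis+

lemma Ident_M:
  assumes "a \<in> Obj C"
  shows "Ident C a \<in> M"
  using Ident_Comp Ident_in_hom[OF assms] by (intro M_I[of _ a a]) metis+

text \<open>The filler arises by lifting twice, first against \<open>m\<close> and then against
  \<open>n\<close>. This lets a subobject of a subobject of \<open>c\<close> count as a subobject of
  \<open>c\<close>.\<close>

lemma Comp_M:
  assumes m: "m \<in> M" "m \<in> hom C b c" and n: "n \<in> M" "n \<in> hom C a b"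
  shows "m \<cdot> n \<in> M"
proof (rule M_I[OF Comp_in_hom[OF n(2) m(2)]])
  fix e p q u v
  assume e: "e \<in> Q" "e \<in> hom C p q" and u: "u \<in> hom C p a" and v: "v \<in> hom C q c"
    and eq: "m \<cdot> n \<cdot> u = v \<cdot> e"
  have "m \<cdot> (n \<cdot> u) = v \<cdot> e" using eq u m n by (simp add: Comp_assoc)
  then obtain w where w: "w \<in> hom C q b" "w \<cdot> e = n \<cdot> u" "m \<cdot> w = v"
    using lift[OF e(1) m(1) e(2) m(2) Comp_in_hom[OF u n(2)] v] by blast
  then obtain x where x: "x \<in> hom C q a" "x \<cdot> e = u" "n \<cdot> x = w"
    using lift[OF e(1) n(1) e(2) n(2) u w(1)] by metis
  then have "m \<cdot> n \<cdot> x = v" using m n w by (simp add: Comp_assoc)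
  then show "\<exists>w\<in>hom C q a. w \<cdot> e = u \<and> m \<cdot> n \<cdot> w = v" using x by blast
qed

section \<open>Images and the fibres of the image map\<close>

text \<open>The embedding in a factorisation is unique only up to equivalence, so an arbitrary one
  is chosen and its class is taken.\<close>

definition image_subobject :: "_ \<Rightarrow> _ set" where
  "image_subobject f = subobject_rel C M (Cod C f) ``
     {SOME m. m \<in> M \<and> Cod C m = Cod C f \<and> (\<exists>e\<in>Q. e \<in> hom C (Dom C f) (Dom C m) \<and> f = m \<cdot> e)}"

lemma image_subobjectE:
  assumes "f \<in> hom C a s"
  obtains e m t where "e \<in> Q" "m \<in> M" "e \<in> hom C a t" "m \<in> hom C t s" "f = m \<cdot> e"
    "image_subobject f = subobject_rel C M s `` {m}"
proof -
  define P where "P m \<longleftrightarrow> m \<in> M \<and> Cod C m = Cod C f \<and>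
    (\<exists>e\<in>Q. e \<in> hom C (Dom C f) (Dom C m) \<and> f = m \<cdot> e)" for m
  have f: "Dom C f = a" "Cod C f = s" using assms by (auto simp: hom_def)
  obtain e m t where "e \<in> Q" "m \<in> M" "e \<in> hom C a t" "m \<in> hom C t s" "f = m \<cdot> e"
    using factorisation[OF assms] .
  then have "P m" using f unfolding P_def by (auto simp: hom_def)
  define n where "n = (SOME m. P m)"
  have img: "image_subobject f = subobject_rel C M s `` {n}"
    unfolding image_subobject_def n_def P_def f ..
  have "P n" unfolding n_def using \<open>P m\<close> by (rule someI)
  then obtain e where e: "e \<in> Q" "e \<in> hom C a (Dom C n)" "f = n \<cdot> e" and n: "n \<in> M" "Cod C n = s"
    unfolding P_def f by blast
  then have "n \<in> hom C (Dom C n) s" using M_Mor unfolding hom_def by blast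
  then show thesis using that[OF e(1) n(1) e(2) _ e(3) img] by blast
qed

text \<open>The filler of the square with \<open>e\<close> on one side and \<open>m'\<close> on the
  other compares the two embeddings. Applied in both directions, it shows that the image does not
  depend on the factorisation.\<close>

lemma factors_through_if_eq_Comp:
  assumes "e \<in> Q" "e \<in> hom C a t" "m \<in> hom C t s" "e' \<in> hom C a t'"
    "m' \<in> M" "m' \<in> hom C t' s" "m \<cdot> e = m' \<cdot> e'"
  shows "factors_through C m m'"
proof -
  obtain w where "w \<in> hom C t t'" "m' \<cdot> w = m"
    using lift[OF assms(1,5,2,6,4,3)] assms(7) by metis
  moreover have "Dom C m = t" "Dom C m' = t'" using assms(3,6) by (auto simp: hom_def)
  ultimately show ?thesis unfolding factors_through_def by blast
qed

lemma image_subobject_fibre: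
  assumes m: "m \<in> M" "m \<in> hom C t s"
  shows "{f \<in> hom C a s. image_subobject f = subobject_rel C M s `` {m}} =
    (\<lambda>e. m \<cdot> e) ` (Q \<inter> hom C a t)" (is "?L = ?R")
proof (intro set_eqI iffI)
  fix f assume "f \<in> ?L"
  then have f: "f \<in> hom C a s" and img: "image_subobject f = subobject_rel C M s `` {m}" by auto
  obtain e n t' where e: "e \<in> Q" "e \<in> hom C a t'" and n: "n \<in> M" "n \<in> hom C t' s"
    and fn: "f = n \<cdot> e" and img': "image_subobject f = subobject_rel C M s `` {n}"
    using image_subobjectE[OF f] .
  have "(m, n) \<in> subobject_rel C M s"
    using img img' n m by (metis (mono_tags, lifting) M_Mor eq_equiv_class_iff
      equiv_subobject_rel hom_def mem_Collect_eq)
  then obtain i j where i: "i \<in> hom C t' t" "n = m \<cdot> i" and j: "j \<in> hom C t t'" "m = n \<cdot> j"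
    using m n unfolding subobject_rel_def factors_through_def hom_def by auto
  \<comment> \<open>Equivalent embeddings have isomorphic domains: since \<open>n\<close> and
    \<open>m\<close> are monic, \<open>i\<close> and \<open>j\<close> are mutually inverse. Hence
    \<open>i\<close> carries the \<open>Q\<close>-part over \<open>n\<close> to one over
    \<open>m\<close>.\<close>
  have "n \<cdot> (j \<cdot> i) = n \<cdot> Ident C t'" "m \<cdot> (i \<cdot> j) = m \<cdot> Ident C t"
    using i j m n by (metis Comp_assoc Comp_Ident)+
  then have "j \<cdot> i = Ident C t'" "i \<cdot> j = Ident C t"
    using monic_cancel[OF M_monic[OF n(1)] n(2) Comp_in_hom[OF i(1) j(1)]]
      monic_cancel[OF M_monic[OF m(1)] m(2) Comp_in_hom[OF j(1) i(1)]]
      Ident_in_hom hom_Obj i(1) by blast+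
  then have "i \<cdot> e \<in> Q" using iso_Comp_Q[OF e i(1) j(1)] by blast
  moreover have "f = m \<cdot> (i \<cdot> e)" using fn i(2) Comp_assoc[OF e(2) i(1) m(2)] by simp
  ultimately show "f \<in> ?R" using Comp_in_hom[OF e(2) i(1)] by blast
next
  fix f assume "f \<in> ?R"
  then obtain e where e: "e \<in> Q" "e \<in> hom C a t" and fm: "f = m \<cdot> e" by blast
  then have f: "f \<in> hom C a s" using Comp_in_hom m by blast
  obtain e' n t' where e': "e' \<in> Q" "e' \<in> hom C a t'" and n: "n \<in> M" "n \<in> hom C t' s"
    and fn: "f = n \<cdot> e'" and img: "image_subobject f = subobject_rel C M s `` {n}"
    using image_subobjectE[OF f] .
  have "factors_through C n m" "factors_through C m n"
    using factors_through_if_eq_Comp[OF e' n(2) e(2) m] factors_through_if_eq_Comp[OF e m(2) e'(2) n]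
      fm fn by auto
  then have "(n, m) \<in> subobject_rel C M s"
    using m n unfolding subobject_rel_def hom_def by blast
  then show "f \<in> ?L"
    using f img equiv_class_eq[OF equiv_subobject_rel[OF M_Mor]] by blast
qed

lemma card_image_subobject_fibre:
  assumes "m \<in> M" "m \<in> hom C t s"
  shows "card {f \<in> hom C a s. image_subobject f = subobject_rel C M s `` {m}} =
    card (Q \<inter> hom C a t)"
  unfolding image_subobject_fibre[OF assms]
  by (rule card_image, rule inj_onI)
    (use assms M_monic monic_cancel in blast)

section \<open>Counting \<open>Q\<close>-morphisms by well-founded induction\<close>

text \<open>The induction step. The fibre over the class of the identity consists of the
  \<open>Q\<close>-morphisms into \<open>s\<close>; all other fibres agree in size by
  \<open>proper\<close>, so they can be subtracted from the equal totals.\<close>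

lemma card_Q_eq_at:
  assumes s: "s \<in> Obj C" and fin: "finite (hom C a s)" "finite (hom C b s)"
    and card: "card (hom C a s) = card (hom C b s)"
    and proper: "\<And>n t. n \<in> M \<Longrightarrow> n \<in> hom C t s \<Longrightarrow> \<not> factors_through C (Ident C s) n \<Longrightarrow>
      card (Q \<inter> hom C a t) = card (Q \<inter> hom C b t)"
  shows "card (Q \<inter> hom C a s) = card (Q \<inter> hom C b s)"
proof -
  define fib where "fib d X = {f \<in> hom C d s. image_subobject f = X}" for d X
  define top where "top = subobject_rel C M s `` {Ident C s}"
  \<comment> \<open>There may be infinitely many subobjects of \<open>s\<close>, so the sums range
    over those that occur as images from \<open>a\<close> or \<open>b\<close>. Using one index set
    for both allows empty fibres, and \<open>top\<close> is inserted because it need not be an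
    image.\<close>
  define T where "T = insert top (image_subobject ` (hom C a s \<union> hom C b s))"
  have T: "finite T" "top \<in> T" using fin unfolding T_def by auto
  have sum: "(\<Sum>X\<in>T. card (fib d X)) = card (hom C d s)" if "d = a \<or> d = b" for d
    using sum.group[of "hom C d s" T image_subobject "\<lambda>_. 1::nat"] fin that T(1)
    unfolding fib_def T_def by auto
  have top_fib: "card (fib d top) = card (Q \<inter> hom C d s)" for d
    unfolding fib_def top_def
    by (rule card_image_subobject_fibre[OF Ident_M[OF s] Ident_in_hom[OF s]])
  have "card (fib a X) = card (fib b X)" if "X \<in> T - {top}" for X
  proof -
    from that obtain d f where "f \<in> hom C d s" "X = image_subobject f" unfolding T_def by blast
    then obtain n t where n: "n \<in> M" "n \<in> hom C t s" and X: "X = subobject_rel C M s `` {n}"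
      using image_subobjectE by metis
    \<comment> \<open>Every embedding into \<open>s\<close> factors through the identity, so the
      converse factorisation would put \<open>n\<close> into the top class.\<close>
    have "\<not> factors_through C (Ident C s) n"
    proof
      assume "factors_through C (Ident C s) n"
      moreover have "factors_through C n (Ident C s)"
        using n s Ident_in_hom[OF s] Ident_Comp[OF n(2)]
        unfolding factors_through_def hom_def by auto
      ultimately have "(n, Ident C s) \<in> subobject_rel C M s"
        using n Ident_M[OF s] Ident_in_hom[OF s] unfolding subobject_rel_def hom_def by blast
      then have "X = top"
        unfolding X top_def using equiv_class_eq[OF equiv_subobject_rel[OF M_Mor]] by blast
      then show False using that by blast
    qed
    then show ?thesis
      using proper[OF n] card_image_subobject_fibre[OF n] unfolding fib_def X by simp
  qed
  then have "(\<Sum>X\<in>T - {top}. card (fib a X)) = (\<Sum>X\<in>T - {top}. card (fib b X))"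
    by (rule sum.cong[OF refl])
  moreover have "(\<Sum>X\<in>T. card (fib a X)) = (\<Sum>X\<in>T. card (fib b X))"
    using sum card by simp
  ultimately have "card (fib a top) = card (fib b top)"
    using sum.remove[OF T, of "\<lambda>X. card (fib a X)"] sum.remove[OF T, of "\<lambda>X. card (fib b X)"]
    by linarith
  then show ?thesis unfolding top_fib .
qed

text \<open>By minimal counterexample. Minimality is available only among subobjects of one fixed
  object, so the failing objects are represented by embeddings into \<open>c\<close>, with
  \<open>c\<close> itself represented by its identity.\<close>

lemma card_Q_eq:
  assumes wf: "M_well_founded C M"
    and fin: "\<And>c. c \<in> Obj C \<Longrightarrow> finite (hom C a c)" "\<And>c. c \<in> Obj C \<Longrightarrow> finite (hom C b c)"
    and card: "\<And>c. c \<in> Obj C \<Longrightarrow> card (hom C a c) = card (hom C b c)"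
    and c: "c \<in> Obj C"
  shows "card (Q \<inter> hom C a c) = card (Q \<inter> hom C b c)"
proof (rule ccontr)
  define bad where "bad m \<longleftrightarrow> m \<in> M \<and> Cod C m = c \<and>
    card (Q \<inter> hom C a (Dom C m)) \<noteq> card (Q \<inter> hom C b (Dom C m))" for m
  define S where "S = (\<lambda>m. subobject_rel C M c `` {m}) ` Collect bad"
  note equiv = equiv_subobject_rel[OF M_Mor, of c]
  assume "card (Q \<inter> hom C a c) \<noteq> card (Q \<inter> hom C b c)"
  then have "bad (Ident C c)"
    using Ident_M[OF c] Ident_in_hom[OF c] unfolding bad_def hom_def by auto
  then have "S \<noteq> {}" unfolding S_def by blast
  moreover have "S \<subseteq> subobjects C M c"
    unfolding S_def subobjects_def bad_def by (auto intro: quotientI)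
  ultimately obtain X where X: "X \<in> S" "\<And>Y. Y \<in> S \<Longrightarrow> subobject_le C Y X \<Longrightarrow> Y = X"
    using wf c unfolding M_well_founded_def by meson
  obtain m where "bad m" and Xm: "X = subobject_rel C M c `` {m}" using X(1) unfolding S_def by blast
  define s where "s = Dom C m"
  have m: "m \<in> M" "m \<in> hom C s c"
    and neq: "card (Q \<inter> hom C a s) \<noteq> card (Q \<inter> hom C b s)"
    using \<open>bad m\<close> M_Mor unfolding bad_def s_def hom_def by auto
  note s = hom_Obj(1)[OF m(2)]
  have "card (Q \<inter> hom C a t) = card (Q \<inter> hom C b t)"
    if n: "n \<in> M" "n \<in> hom C t s" and proper: "\<not> factors_through C (Ident C s) n" for n t
  proof (rule ccontr)
    assume neq: "card (Q \<inter> hom C a t) \<noteq> card (Q \<inter> hom C b t)"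
    \<comment> \<open>A failing proper subobject \<open>n\<close> of \<open>s\<close> gives a
      failing subobject of \<open>c\<close> below \<open>m\<close>, and minimality makes it
      equivalent to \<open>m\<close>.\<close>
    have mn: "m \<cdot> n \<in> M" "m \<cdot> n \<in> hom C t c" using Comp_M[OF m n] Comp_in_hom[OF n(2) m(2)] .
    then have cod: "Cod C (m \<cdot> n) = c" "Cod C m = c" using m by (auto simp: hom_def)
    have "bad (m \<cdot> n)" using mn neq unfolding bad_def hom_def by auto
    then have "subobject_rel C M c `` {m \<cdot> n} \<in> S" unfolding S_def by blast
    moreover have "factors_through C (m \<cdot> n) m"
      using m n mn unfolding factors_through_def hom_def by auto
    ultimately have "subobject_rel C M c `` {m \<cdot> n} = subobject_rel C M c `` {m}"
      using X(2) subobject_le_iff[OF M_Mor mn(1) cod(1) m(1) cod(2)] unfolding Xm by blast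
    then have "(m \<cdot> n, m) \<in> subobject_rel C M c"
      using eq_equiv_class_iff[OF equiv] mn(1) m(1) cod by blast
    then have "factors_through C m (m \<cdot> n)" by (simp add: subobject_rel_def)
    then obtain j where j: "j \<in> hom C s t" "m = m \<cdot> n \<cdot> j"
      using m mn unfolding factors_through_def hom_def by auto
    \<comment> \<open>Cancelling the monomorphism \<open>m\<close> shows that \<open>j\<close> is a
      right inverse of \<open>n\<close>, contradicting that \<open>n\<close> is proper.\<close>
    have "m \<cdot> (n \<cdot> j) = m \<cdot> Ident C s"
      using j Comp_assoc[OF j(1) n(2) m(2)] Comp_Ident[OF m(2)] by simp
    then have "n \<cdot> j = Ident C s"
      using monic_cancel[OF M_monic[OF m(1)] m(2) Comp_in_hom[OF j(1) n(2)] Ident_in_hom[OF s]]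
      by blast
    then have "factors_through C (Ident C s) n"
      using j(1) n(2) Ident_in_hom[OF s] unfolding factors_through_def hom_def by auto
    then show False using proper by blast
  qed
  then have "card (Q \<inter> hom C a s) = card (Q \<inter> hom C b s)"
    using card_Q_eq_at[OF s fin(1)[OF s] fin(2)[OF s] card[OF s]] by blast
  then show False using neq by blast
qed

section \<open>Left-combinatoriality\<close>

lemma left_combinatorialI:
  assumes fin: "locally_finite C" and wf: "M_well_founded C M"
  shows "left_combinatorial C"
  unfolding left_combinatorial_def
proof (intro ballI iffI)
  fix a b assume a: "a \<in> Obj C" and b: "b \<in> Obj C"
  assume eqpoll: "\<forall>c \<in> Obj C. hom C a c \<approx> hom C b c"
  have finite_hom: "finite (hom C d c)" if "d \<in> Obj C" "c \<in> Obj C" for c d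
    using fin that unfolding locally_finite_def by blast
  have "card (hom C a c) = card (hom C b c)" if "c \<in> Obj C" for c
    using eqpoll that by (auto simp: eqpoll_def bij_betw_same_card)
  then have card: "card (Q \<inter> hom C a c) = card (Q \<inter> hom C b c)" if "c \<in> Obj C" for c
    using card_Q_eq[OF wf finite_hom[OF a] finite_hom[OF b] _ that] by blast
  have "Ident C a \<in> Q \<inter> hom C a a" "Ident C b \<in> Q \<inter> hom C b b"
    using Ident_Q Ident_in_hom a b by auto
  \<comment> \<open>Comparing the counts at \<open>c = a\<close> and at \<open>c = b\<close> turns
    the two identities into the existence of \<open>Q\<close>-morphisms in both directions.\<close>
  then have "card (Q \<inter> hom C a a) \<noteq> 0" "card (Q \<inter> hom C b b) \<noteq> 0"
    using finite_hom a b by (auto simp: card_eq_0_iff)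
  then have "card (Q \<inter> hom C b a) \<noteq> 0" "card (Q \<inter> hom C a b) \<noteq> 0"
    using card a b by auto
  then have "Q \<inter> hom C b a \<noteq> {}" "Q \<inter> hom C a b \<noteq> {}" by force+
  then show "isomorphic C a b"
    using isomorphic_if_epics[OF finite_hom[OF a a]] Q_epic by blast
qed (rule isomorphic_hom_eqpoll)

end

theorem theorem4p5:
  fixes C :: "('o, 'm) category"
    and Q M :: "'m set"
  assumes "category C"
    and "locally_small TYPE('u) C"
    and "well_powered TYPE('u) C"
    and "well_copowered TYPE('u) C"
    and "locally_finite C"
    and "proper_factorisation_system C Q M"
    and "M_well_founded C M"
  shows "left_combinatorial C"
proof -
  interpret proper_factorisation_category C Q M
    using assms by (simp add: proper_factorisation_category_def
      proper_factorisation_category_axioms_def)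
  show ?thesis using left_combinatorialI assms by blast
qed

end
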